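(* Let $f(x)=x^TAx+2a^Tx+a_0$ and $g(x)=x^TBx+2b^Tx+b_0$ be functions on $\mathbb{R}^n$, where $A,B$ are real symmetric $n\times n$ matrices, $a,b\in\mathbb{R}^n$ and $a_0,b_0\in\mathbb{R}$. Let $\mathbf{R}(f,g)=\{(f(x),g(x)) : x\in\mathbb{R}^n\}\subset\mathbb{R}^2$. Then $\mathbf{R}(f,g)$ is non-convex if and only if there exist $\alpha,\beta\in\mathbb{R}$ such that $\{g=\beta\}$ separates $\{f=\alpha\}$ or $\{f=\alpha\}$ separates $\{g=\beta\}$. More precisely: (a) when both $f$ and $g$ are quadratic (i.e. $A\neq 0$ and $B\neq 0$), $\mathbf{R}(f,g)$ is non-convex if and only if there exist $\alpha,\beta\in\mathbb{R}$ such that $\{f=\alpha\}$ and $\{g=\beta\}$ mutually separate each other (i.e. $\{g=\beta\}$ separates $\{f=\alpha\}$ and $\{f=\alpha\}$ separates $\{g=\beta\}$); (b) when one of $f$ and $g$ is affine and the other is quadratic, $\mathbf{R}(f,g)$ is non-convex if and only if some level set of the affine function separates some level set of the quadratic function; that is, if $B=0$ and $A\ne0$, if and only if there exist $\alpha,\beta\in\mathbb{R}$ such that $\{g=\beta\}$ separates $\{f=\alpha\}$, and if $A=0$ and $B\neq0$, if and only if there exist $\alpha,\beta\in\mathbb{R}$ such that $\{f=\beta\}$ separates $\{g=\alpha\}$.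
   Context: For a function $h:\mathbb{R}^n\to\mathbb{R}$ and $\gamma\in\mathbb{R}$, $\{h=\gamma\}=\{x\in\mathbb{R}^n : h(x)=\gamma\}$ is the $\gamma$-level set. Separation: the level set $\{g=\beta\}$ is said to separate the level set $\{f=\alpha\}$ if there are non-empty subsets $L^-$ and $L^+$ of $\{f=\alpha\}$ such that $L^-\cup L^+=\{f=\alpha\}$ and $(g(u^-)-\beta)(g(u^+)-\beta)<0$ for all $u^-\in L^-$ and all $u^+\in L^+$. *)

theory Defs
  imports "HOL-Analysis.Analysis"
begin

definition quad_fun :: "real^'n^'n \<Rightarrow> real^'n \<Rightarrow> real \<Rightarrow> real^'n \<Rightarrow> real" where
  "quad_fun A a a0 x = x \<bullet> (A *v x) + 2 * (a \<bullet> x) + a0"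

definition level_set :: "(real^'n \<Rightarrow> real) \<Rightarrow> real \<Rightarrow> (real^'n) set" where
  "level_set h \<gamma> = {x. h x = \<gamma>}"

(* "level_separates g \<beta> f \<alpha>" means that {g = \<beta>} separates {f = \<alpha>}. The relation
   takes g and \<beta> rather than the set {g = \<beta>} because the sign of g - \<beta> matters. *)
definition level_separates ::
  "(real^'n \<Rightarrow> real) \<Rightarrow> real \<Rightarrow> (real^'n \<Rightarrow> real) \<Rightarrow> real \<Rightarrow> bool" where
  "level_separates g \<beta> f \<alpha> \<longleftrightarrow>
     (\<exists>Lm Lp. Lm \<noteq> {} \<and> Lp \<noteq> {} \<and> Lm \<subseteq> level_set f \<alpha> \<and> Lp \<subseteq> level_set f \<alpha> \<and>
        Lm \<union> Lp = level_set f \<alpha> \<and>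
        (\<forall>um\<in>Lm. \<forall>up\<in>Lp. (g um - \<beta>) * (g up - \<beta>) < 0))"

definition joint_range :: "(real^'n \<Rightarrow> real) \<Rightarrow> (real^'n \<Rightarrow> real) \<Rightarrow> (real \<times> real) set" where
  "joint_range f g = range (\<lambda>x. (f x, g x))"

end

theory Submission
  imports Defs "HOL-Real_Asymp.Real_Asymp"
begin

text \<open>If the joint range misses a point \<open>(\<alpha>, \<beta>)\<close> of a chord, rotate coordinates to get
  combinations \<open>h\<close>, \<open>k\<close> of \<open>f - \<alpha>\<close>, \<open>g - \<beta>\<close> without common zero such that \<open>h\<close> vanishes at
  both ends \<open>x\<close>, \<open>y\<close> of the chord and \<open>k\<close> changes sign between them. Write \<open>v = y - x\<close>; the
  quadratic part of \<open>h\<close> does not vanish on \<open>v\<close>, since otherwise \<open>h = 0\<close> on the segment and \<open>k\<close>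
  has a zero there. For every \<open>w\<close> conjugate to \<open>v\<close>, the set \<open>h = 0\<close> in the plane spanned by
  \<open>v\<close>, \<open>w\<close> is a conic with two branches on which \<open>k\<close> has opposite signs. Comparing growth
  along the branches shows that some \<open>l = k + \<kappa> h\<close> is affine. On the line through \<open>x\<close> and \<open>y\<close>,
  any combination \<open>p h + q l\<close> with \<open>p \<noteq> 0\<close> then has zeros on both sides of \<open>l = 0\<close>. If \<open>A \<noteq> 0\<close>,
  then \<open>f - \<alpha>\<close> is such a combination, and likewise for \<open>B\<close> and \<open>g - \<beta>\<close>, so the missed point
  itself gives the separating levels.\<close>

section \<open>Sign and growth along the branches of a plane conic\<close>

text \<open>Divided by \<open>t ^ 4\<close>, left side minus right side tends to
  \<open>u2\<^sup>2\<close>, yet it is never positive.\<close>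

lemma quartic_le_quadratic_imp_zero:
  fixes u0 u1 u2 c0 c1 c2 :: real
  assumes "\<And>t. (u0 + u1 * t + u2 * t\<^sup>2)\<^sup>2 \<le> c0 + c1 * t + c2 * t\<^sup>2"
  shows "u2 = 0"
proof -
  have "((\<lambda>t::real. ((u0 + u1 * t + u2 * t\<^sup>2)\<^sup>2 - (c0 + c1 * t + c2 * t\<^sup>2)) / t ^ 4) \<longlongrightarrow> u2\<^sup>2) at_top"
  proof -
    have "((\<lambda>t::real. (u0 * (1 / t\<^sup>2) + u1 * (1 / t) + u2)\<^sup>2
            - (c0 * (1 / t ^ 4) + c1 * (1 / t ^ 3) + c2 * (1 / t\<^sup>2)))
          \<longlongrightarrow> (u0 * 0 + u1 * 0 + u2)\<^sup>2 - (c0 * 0 + c1 * 0 + c2 * 0)) at_top"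
      by (intro tendsto_intros; real_asymp)
    moreover have "\<forall>\<^sub>F t::real in at_top. (u0 * (1 / t\<^sup>2) + u1 * (1 / t) + u2)\<^sup>2
            - (c0 * (1 / t ^ 4) + c1 * (1 / t ^ 3) + c2 * (1 / t\<^sup>2))
          = ((u0 + u1 * t + u2 * t\<^sup>2)\<^sup>2 - (c0 + c1 * t + c2 * t\<^sup>2)) / t ^ 4"
      using eventually_gt_at_top[of 0]
      by eventually_elim (simp add: field_simps power2_eq_square power3_eq_cube power4_eq_xxxx)
    ultimately show ?thesis
      by (simp add: tendsto_cong)
  qed
  moreover have "((u0 + u1 * t + u2 * t\<^sup>2)\<^sup>2 - (c0 + c1 * t + c2 * t\<^sup>2)) / t ^ 4 \<le> 0" for t :: real
    using assms[of t] by (intro divide_nonpos_nonneg) auto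
  ultimately have "u2\<^sup>2 \<le> 0"
    by (intro tendsto_upperbound[where F = at_top]) auto
  then show ?thesis by simp
qed

lemma affine_pos_imp_slope_zero:
  fixes b0 b1 :: real
  assumes "\<And>t. 0 < b0 + b1 * t"
  shows "b1 = 0"
proof (rule ccontr)
  assume "b1 \<noteq> 0"
  then show False using assms[of "- b0 / b1"] by simp
qed

text \<open>Intermediate value theorem, in the form that carries a sign along a path avoiding the
  zero set.\<close>

lemma pos_on_segment_of_nonzero:
  fixes \<phi> :: "real \<Rightarrow> real"
  assumes "continuous_on {0..1} \<phi>" "0 < \<phi> 0" "\<And>\<theta>. \<theta> \<in> {0..1} \<Longrightarrow> \<phi> \<theta> \<noteq> 0"
  shows "0 < \<phi> 1"
proof (rule ccontr)
  assume "\<not> 0 < \<phi> 1"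
  then have "\<exists>\<theta>\<ge>0. \<theta> \<le> 1 \<and> \<phi> \<theta> = 0"
    using assms by (intro IVT2') auto
  then show False using assms(3) by auto
qed

text \<open>The conic \<open>s\<^sup>2 = Q t\<close> consists of two branches that the second polynomial keeps
  apart. If \<open>Q\<close> vanished somewhere, the branches would meet at its zero closest to the origin.\<close>

lemma separated_conic:
  fixes q1 q2 e b0 b1 r0 r1 r2 :: real
  defines "Q \<equiv> \<lambda>t. 1/4 + q1 * t + q2 * t\<^sup>2"
  defines "P \<equiv> \<lambda>s t. e * s\<^sup>2 + 2 * s * (b0 + b1 * t) + (r0 + r1 * t + r2 * t\<^sup>2)"
  assumes nz: "\<And>s t. s\<^sup>2 = Q t \<Longrightarrow> P s t \<noteq> 0"
    and pos: "0 < P (1/2) 0" and neg: "P (-1/2) 0 < 0"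
  shows "b1 = 0" and "r2 + e * q2 = 0"
proof -
  have sqrt4: "sqrt (1/4) = 1/2"
    by (simp add: real_sqrt_divide)
  \<comment> \<open>Each branch is followed from its known point \<open>(1/2, 0)\<close> or
    \<open>(-1/2, 0)\<close> at \<theta> = 0. While \<open>Q\<close> is nonnegative the path stays
    on the conic, and \<open>nz\<close> forbids a sign change of \<open>P\<close>.\<close>
  have branches: "0 < P (sqrt (Q t)) t \<and> P (- sqrt (Q t)) t < 0"
    if nonneg: "\<And>\<theta>. \<theta> \<in> {0..1} \<Longrightarrow> 0 \<le> Q (\<theta> * t)" for t
  proof
    have "0 < P (sqrt (Q (1 * t))) (1 * t)"
    proof (rule pos_on_segment_of_nonzero[where \<phi> = "\<lambda>\<theta>. P (sqrt (Q (\<theta> * t))) (\<theta> * t)"])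
      show "continuous_on {0..1} (\<lambda>\<theta>. P (sqrt (Q (\<theta> * t))) (\<theta> * t))"
        unfolding P_def Q_def by (intro continuous_intros)
      show "0 < P (sqrt (Q (0 * t))) (0 * t)"
        using pos by (simp add: Q_def sqrt4)
    qed (use nz nonneg in simp)
    then show "0 < P (sqrt (Q t)) t" by simp
    have "0 < - P (- sqrt (Q (1 * t))) (1 * t)"
    proof (rule pos_on_segment_of_nonzero[where \<phi> = "\<lambda>\<theta>. - P (- sqrt (Q (\<theta> * t))) (\<theta> * t)"])
      show "continuous_on {0..1} (\<lambda>\<theta>. - P (- sqrt (Q (\<theta> * t))) (\<theta> * t))"
        unfolding P_def Q_def by (intro continuous_intros)
      show "0 < - P (- sqrt (Q (0 * t))) (0 * t)"
        using neg by (simp add: Q_def sqrt4)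
    qed (use nz nonneg in simp)
    then show "P (- sqrt (Q t)) t < 0" by simp
  qed
  have Qpos: "0 < Q t" for t
  proof (rule ccontr)
    assume "\<not> 0 < Q t"
    define Z where "Z = {\<theta> \<in> {0..1}. Q (\<theta> * t) = 0}"
    have contQ: "continuous_on S (\<lambda>\<theta>. Q (\<theta> * t))" for S
      unfolding Q_def by (intro continuous_intros)
    have "\<exists>\<theta>\<ge>0. \<theta> \<le> 1 \<and> Q (\<theta> * t) = 0"
      using \<open>\<not> 0 < Q t\<close> by (intro IVT2' contQ) (auto simp: Q_def)
    then have "Z \<noteq> {}" unfolding Z_def by auto
    moreover have "compact Z"
      unfolding Z_def
      using continuous_closed_preimage_constant[OF contQ, of "{0..1}" 0]
      by (simp add: compact_eq_bounded_closed bounded_subset[of "{0..1::real}"] subset_iff)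
    ultimately obtain \<theta>0 where \<theta>0: "\<theta>0 \<in> Z" and least: "\<And>\<theta>. \<theta> \<in> Z \<Longrightarrow> \<theta>0 \<le> \<theta>"
      using compact_attains_inf by metis
    \<comment> \<open>\<open>Q 0 = 1/4\<close> is positive, so a negative value would give a zero no
      later than \<open>\<theta> * \<theta>0\<close>. Minimality then forces
      \<open>\<theta> * \<theta>0 = \<theta>0\<close>, where \<open>Q\<close> is zero, not
      negative.\<close>
    have "0 \<le> Q (\<theta> * (\<theta>0 * t))" if \<theta>: "\<theta> \<in> {0..1}" for \<theta>
    proof (rule ccontr)
      assume "\<not> 0 \<le> Q (\<theta> * (\<theta>0 * t))"
      then have "\<exists>x\<ge>0. x \<le> \<theta> * \<theta>0 \<and> Q (x * t) = 0"
        using \<theta> \<theta>0 by (intro IVT2' contQ) (auto simp: Q_def Z_def mult.assoc)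
      then obtain x where x: "0 \<le> x" "x \<le> \<theta> * \<theta>0" "Q (x * t) = 0" by blast
      have "\<theta> * \<theta>0 \<le> \<theta>0"
        using \<theta> \<theta>0 by (auto simp: Z_def intro: mult_left_le_one_le)
      with x \<theta>0 have "x \<in> Z" by (auto simp: Z_def)
      with least x \<open>\<theta> * \<theta>0 \<le> \<theta>0\<close> have "\<theta> * \<theta>0 = \<theta>0" "x = \<theta>0"
        by (meson order.antisym order.trans)+
      then show False using \<open>\<not> 0 \<le> Q (\<theta> * (\<theta>0 * t))\<close> x
        by (metis mult.assoc order_refl)
    qed
    \<comment> \<open>At \<open>\<theta>0 * t\<close> both branches have \<open>s = 0\<close>, so
      \<open>P\<close> would be positive and negative at one point.\<close>
    from branches[OF this] \<theta>0 show False by (auto simp: Z_def)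
  qed
  have br: "0 < P (sqrt (Q t)) t" "P (- sqrt (Q t)) t < 0" for t
    using branches[of t] Qpos by (auto intro: less_imp_le)
  have sq: "(sqrt (Q t))\<^sup>2 = Q t" for t
    using Qpos[of t] by simp
  \<comment> \<open>The branch values differ by
    \<open>4 * sqrt (Q t) * (b0 + b1 * t)\<close>.\<close>
  have "0 < b0 + b1 * t" for t
  proof -
    have "0 < 4 * (sqrt (Q t) * (b0 + b1 * t))"
      using br[of t] by (simp add: P_def)
    then show ?thesis using Qpos[of t] by (simp add: zero_less_mult_iff)
  qed
  then show b1: "b1 = 0" by (rule affine_pos_imp_slope_zero)
  \<comment> \<open>As \<open>b1 = 0\<close>, the branch values are the bracket plus and minus
    \<open>2 * sqrt (Q t) * b0\<close>. Opposite signs bound the bracket in modulus by that term;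
    squaring bounds a quartic by a quadratic.\<close>
  have "((e/4 + r0) + (e * q1 + r1) * t + (r2 + e * q2) * t\<^sup>2)\<^sup>2
        \<le> b0\<^sup>2 + (4 * b0\<^sup>2 * q1) * t + (4 * b0\<^sup>2 * q2) * t\<^sup>2" for t
  proof -
    let ?u = "(e/4 + r0) + (e * q1 + r1) * t + (r2 + e * q2) * t\<^sup>2"
    have u: "?u = e * Q t + (r0 + r1 * t + r2 * t\<^sup>2)"
      by (simp add: Q_def algebra_simps)
    have "\<bar>?u\<bar> \<le> \<bar>2 * sqrt (Q t) * b0\<bar>"
      unfolding u using br[of t] by (simp add: P_def sq b1)
    then have "?u\<^sup>2 \<le> (2 * sqrt (Q t) * b0)\<^sup>2"
      by (simp only: abs_le_square_iff)
    also have "\<dots> = 4 * Q t * b0\<^sup>2"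
      by (simp add: power_mult_distrib sq)
    also have "\<dots> = b0\<^sup>2 + (4 * b0\<^sup>2 * q1) * t + (4 * b0\<^sup>2 * q2) * t\<^sup>2"
      by (simp add: Q_def algebra_simps)
    finally show ?thesis .
  qed
  then show "r2 + e * q2 = 0"
    by (rule quartic_le_quadratic_imp_zero)
qed

section \<open>Algebra of quadratic functions on lines and planes\<close>

lemma inner_symmetric_matrix:
  fixes A :: "real^'n^'n"
  assumes "transpose A = A"
  shows "x \<bullet> (A *v y) = y \<bullet> (A *v x)"
  by (metis assms dot_lmul_matrix inner_commute transpose_matrix_vector)

lemma quad_fun_add:
  fixes A :: "real^'n^'n"
  assumes "transpose A = A"
  shows "quad_fun A a a0 (x + y) = quad_fun A a a0 x + 2 * (y \<bullet> (A *v x + a)) + y \<bullet> (A *v y)"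
  using inner_symmetric_matrix[OF assms, of x y]
  by (simp add: quad_fun_def matrix_vector_right_distrib inner_add_left inner_add_right
      algebra_simps inner_commute)

lemma quad_fun_line:
  fixes A :: "real^'n^'n"
  assumes "transpose A = A"
  shows "quad_fun A a a0 (x + s *\<^sub>R v)
    = quad_fun A a a0 x + 2 * s * (v \<bullet> (A *v x + a)) + s\<^sup>2 * (v \<bullet> (A *v v))"
  by (simp add: quad_fun_add[OF assms] matrix_vector_mult_scaleR power2_eq_square)

lemma quad_fun_plane:
  fixes A :: "real^'n^'n"
  assumes "transpose A = A"
  shows "quad_fun A a a0 (x + s *\<^sub>R v + t *\<^sub>R w)
    = quad_fun A a a0 x + s\<^sup>2 * (v \<bullet> (A *v v)) + t\<^sup>2 * (w \<bullet> (A *v w)) + 2 * s * t * (v \<bullet> (A *v w))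
      + 2 * s * (v \<bullet> (A *v x + a)) + 2 * t * (w \<bullet> (A *v x + a))"
  unfolding quad_fun_add[OF assms, of _ _ "x + s *\<^sub>R v" "t *\<^sub>R w"] quad_fun_line[OF assms]
  using inner_symmetric_matrix[OF assms, of w v]
  by (simp add: power2_eq_square matrix_vector_mult_scaleR matrix_vector_right_distrib
      inner_add_right algebra_simps)

lemma quad_fun_lincomb:
  "c * quad_fun A a a0 x + d * quad_fun B b b0 x
    = quad_fun (c *\<^sub>R A + d *\<^sub>R B) (c *\<^sub>R a + d *\<^sub>R b) (c * a0 + d * b0) x"
  by (simp add: quad_fun_def matrix_vector_mult_add_rdistrib scaleR_matrix_vector_assoc[symmetric]
      inner_add_left inner_add_right algebra_simps)

lemma quad_fun_diff_const: "quad_fun A a a0 x - c = quad_fun A a (a0 - c) x"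
  by (simp add: quad_fun_def)

lemma transpose_lincomb:
  fixes A B :: "real^'n^'n"
  assumes "transpose A = A" "transpose B = B"
  shows "transpose (c *\<^sub>R A + d *\<^sub>R B) = c *\<^sub>R A + d *\<^sub>R B"
  using assms by (simp add: vec_eq_iff transpose_def)

text \<open>Polarization: by symmetry, expanding the form at \<open>x + y\<close> leaves twice the
  bilinear form.\<close>

lemma quadratic_form_zero_imp_matrix_zero:
  fixes M :: "real^'n^'n"
  assumes "transpose M = M" and "\<And>u. u \<bullet> (M *v u) = 0"
  shows "M = 0"
proof -
  have "x \<bullet> (M *v y) = 0" for x y
    using assms(2)[of "x + y"] assms(2)[of x] assms(2)[of y] inner_symmetric_matrix[OF assms(1), of x y]
    by (simp add: matrix_vector_right_distrib inner_add_left inner_add_right)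
  then have "M *v y = 0" for y
    using inner_eq_zero_iff by blast
  then show ?thesis by (simp add: matrix_eq)
qed

section \<open>The rotated pair and the dependence of its matrices\<close>

text \<open>The situation after the rotation: relative to the missed point,
  \<open>quad_fun H h h0\<close> measures displacement across the chord and
  \<open>quad_fun K k k0\<close> displacement along it.\<close>

locale separated_quadric =
  fixes H K :: "real^'n^'n" and h k :: "real^'n" and h0 k0 :: real and x y :: "real^'n"
  assumes symH: "transpose H = H" and symK: "transpose K = K"
    and hx: "quad_fun H h h0 x = 0" and hy: "quad_fun H h h0 y = 0"
    and kx: "quad_fun K k k0 x < 0" and ky: "0 < quad_fun K k k0 y"
    and no_common_zero: "\<And>z. quad_fun H h h0 z = 0 \<Longrightarrow> quad_fun K k k0 z \<noteq> 0"
begin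

text \<open>A polynomial in \<open>s\<close> of degree at most two with zeros at 0 and 1 is a
  multiple of \<open>s\<^sup>2 - s\<close>.\<close>

lemma line_eq:
  "quad_fun H h h0 (x + s *\<^sub>R (y - x)) = (s\<^sup>2 - s) * ((y - x) \<bullet> (H *v (y - x)))"
proof -
  define v where "v = y - x"
  have "y = x + 1 *\<^sub>R v" by (simp add: v_def)
  then have "v \<bullet> (H *v x + h) = - (v \<bullet> (H *v v)) / 2"
    using hx hy by (simp only: quad_fun_line[OF symH]) simp
  then show ?thesis
    unfolding v_def[symmetric] by (simp add: quad_fun_line[OF symH] hx algebra_simps)
qed

lemma curvature_nonzero: "(y - x) \<bullet> (H *v (y - x)) \<noteq> 0"
proof
  assume 0: "(y - x) \<bullet> (H *v (y - x)) = 0"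
  \<comment> \<open>The segment is run from \<open>y\<close> to \<open>x\<close>, so positivity at
    \<open>y\<close> would spread to \<open>x\<close>.\<close>
  have "0 < quad_fun K k k0 (x + (1 - 1) *\<^sub>R (y - x))"
  proof (rule pos_on_segment_of_nonzero[where \<phi> = "\<lambda>\<theta>. quad_fun K k k0 (x + (1 - \<theta>) *\<^sub>R (y - x))"])
    show "continuous_on {0..1} (\<lambda>\<theta>. quad_fun K k k0 (x + (1 - \<theta>) *\<^sub>R (y - x)))"
      unfolding quad_fun_line[OF symK] by (intro continuous_intros)
  qed (use ky no_common_zero 0 in \<open>auto simp: line_eq\<close>)
  then show False using kx by simp
qed

text \<open>Choose \<kappa> so that the form of \<open>M\<close> vanishes at \<open>v\<close>. For
  each \<open>w\<close> conjugate to \<open>v\<close> under \<open>H\<close>,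
  \<open>separated_conic\<close> kills the mixed term and the value at \<open>w\<close>. Such
  \<open>w\<close> together with \<open>v\<close> span the space.\<close>

lemma matrices_dependent: "\<exists>\<kappa>. K + \<kappa> *\<^sub>R H = 0"
proof -
  define v where "v = y - x"
  \<comment> \<open>With the midpoint as origin the linear term in \<open>v\<close> drops out
    (\<open>c = 0\<close>), and the ends sit at \<open>s = -1/2\<close> and \<open>s = 1/2\<close>,
    as \<open>separated_conic\<close> expects.\<close>
  define m where "m = (1/2) *\<^sub>R (x + y)"
  define \<eta> where "\<eta> = v \<bullet> (H *v v)"
  have \<eta>: "\<eta> \<noteq> 0" using curvature_nonzero by (simp add: \<eta>_def v_def)
  have xm: "x = m + (-1/2) *\<^sub>R v" and ym: "y = m + (1/2) *\<^sub>R v"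
    by (simp_all add: m_def v_def algebra_simps flip: scaleR_add_left)
  define c where "c = v \<bullet> (H *v m + h)"
  have c0: "c = 0" and hm: "quad_fun H h h0 m = - \<eta>/4"
    using hx hy unfolding xm ym quad_fun_line[OF symH] c_def[symmetric] \<eta>_def[symmetric]
    by (simp_all add: power2_eq_square field_simps)
  define \<kappa> where "\<kappa> = - (v \<bullet> (K *v v)) / \<eta>"
  define M where "M = K + \<kappa> *\<^sub>R H"
  have symM: "transpose M = M"
    using transpose_lincomb[OF symK symH, of 1 \<kappa>] by (simp add: M_def)
  have M: "u \<bullet> (M *v w) = u \<bullet> (K *v w) + \<kappa> * (u \<bullet> (H *v w))" for u w
    by (simp add: M_def matrix_vector_mult_add_rdistrib scaleR_matrix_vector_assoc[symmetric] inner_add_right)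
  have vv: "v \<bullet> (M *v v) = 0"
    using \<eta> by (simp add: M \<kappa>_def \<eta>_def[symmetric])
  have orth: "v \<bullet> (M *v w) = 0 \<and> w \<bullet> (M *v w) = 0" if w: "v \<bullet> (H *v w) = 0" for w
  proof -
    \<comment> \<open>These come from solving the equation of the zero set for
      \<open>s\<^sup>2\<close>, after division by \<eta>; conjugacy removes the term in
      \<open>s * t\<close>.\<close>
    let ?q1 = "- 2 * (w \<bullet> (H *v m + h)) / \<eta>" and ?q2 = "- (w \<bullet> (H *v w)) / \<eta>"
    let ?e = "v \<bullet> (K *v v)" and ?b0 = "v \<bullet> (K *v m + k)" and ?b1 = "v \<bullet> (K *v w)"
    let ?r0 = "quad_fun K k k0 m" and ?r1 = "2 * (w \<bullet> (K *v m + k))" and ?r2 = "w \<bullet> (K *v w)"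
    have kplane: "?e * s\<^sup>2 + 2 * s * (?b0 + ?b1 * t) + (?r0 + ?r1 * t + ?r2 * t\<^sup>2)
        = quad_fun K k k0 (m + s *\<^sub>R v + t *\<^sub>R w)" for s t
      unfolding quad_fun_plane[OF symK] by (simp add: algebra_simps)
    have hplane: "quad_fun H h h0 (m + s *\<^sub>R v + t *\<^sub>R w) = \<eta> * (s\<^sup>2 - (1/4 + ?q1 * t + ?q2 * t\<^sup>2))" for s t
      unfolding quad_fun_plane[OF symH] w hm c_def[symmetric] c0 \<eta>_def[symmetric]
      using \<eta> by (simp add: field_simps)
    have nz: "?e * s\<^sup>2 + 2 * s * (?b0 + ?b1 * t) + (?r0 + ?r1 * t + ?r2 * t\<^sup>2) \<noteq> 0"
      if "s\<^sup>2 = 1/4 + ?q1 * t + ?q2 * t\<^sup>2" for s t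
      unfolding kplane by (rule no_common_zero) (simp add: hplane that)
    have pos: "0 < ?e * (1/2)\<^sup>2 + 2 * (1/2) * (?b0 + ?b1 * 0) + (?r0 + ?r1 * 0 + ?r2 * 0\<^sup>2)"
      unfolding kplane using ky ym by simp
    have neg: "?e * (-1/2)\<^sup>2 + 2 * (-1/2) * (?b0 + ?b1 * 0) + (?r0 + ?r1 * 0 + ?r2 * 0\<^sup>2) < 0"
      unfolding kplane using kx xm by simp
    \<comment> \<open>By conjugacy \<open>?b1\<close> is the mixed term of \<open>M\<close>; by the
      choice of \<kappa> the second expression is \<open>w \<bullet> (M *v w)\<close>.\<close>
    have "?b1 = 0" "?r2 + ?e * ?q2 = 0"
      using separated_conic[OF nz pos neg] by blast+
    then show ?thesis using w by (simp add: M \<kappa>_def)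
  qed
  have "u \<bullet> (M *v u) = 0" for u
  proof -
    \<comment> \<open>Projection onto \<open>v\<close> with respect to \<open>H\<close>, possible
      since \<open>\<eta> \<noteq> 0\<close>; the remainder \<open>w\<close> is conjugate to
      \<open>v\<close>.\<close>
    define s where "s = (v \<bullet> (H *v u)) / \<eta>"
    define w where "w = u - s *\<^sub>R v"
    have "v \<bullet> (H *v w) = 0"
      using \<eta> by (simp add: w_def s_def matrix_vector_mult_diff_distrib matrix_vector_mult_scaleR
          inner_diff_right \<eta>_def[symmetric])
    from orth[OF this] have "v \<bullet> (M *v w) = 0" "w \<bullet> (M *v w) = 0" by blast+
    moreover from this have "w \<bullet> (M *v v) = 0"
      using inner_symmetric_matrix[OF symM] by metis
    moreover have "u = s *\<^sub>R v + w" by (simp add: w_def)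
    ultimately show ?thesis using vv
      by (simp add: matrix_vector_right_distrib matrix_vector_mult_scaleR inner_add_left inner_add_right)
  qed
  then have "M = 0" using symM by (rule quadratic_form_zero_imp_matrix_zero[rotated])
  then show ?thesis unfolding M_def by blast
qed

end

section \<open>Zeros on both sides of an affine function\<close>

text \<open>The affine factor vanishes at a point between 0 and 1, where the sum equals the positive
  \<open>P * (s - s\<^sup>2)\<close>. The leading coefficient \<open>- P\<close> sends the sum to
  minus infinity at both ends, so each side has a root.\<close>

lemma quadratic_vs_affine_roots:
  fixes P e0 e1 :: real
  assumes "P > 0" "e0 < 0" "0 < e0 + e1"
  shows "\<exists>s s'. P * (s - s\<^sup>2) + Q * (e0 + e1 * s) = 0 \<and> P * (s' - s'\<^sup>2) + Q * (e0 + e1 * s') = 0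
    \<and> e0 + e1 * s < 0 \<and> 0 < e0 + e1 * s'"
proof -
  define \<phi> where "\<phi> = (\<lambda>s. P * (s - s\<^sup>2) + Q * (e0 + e1 * s))"
  define z where "z = - e0 / e1"
  have e1: "e1 > 0" using assms by simp
  have z: "e0 + e1 * z = 0" "0 < z" "z < 1"
    using assms e1 by (simp_all add: z_def field_simps)
  have "\<phi> z = P * (z * (1 - z))"
    unfolding \<phi>_def z(1) by (simp add: power2_eq_square algebra_simps)
  then have \<phi>z: "0 < \<phi> z" using z assms(1) by simp
  have cont: "continuous_on S \<phi>" for S
    unfolding \<phi>_def by (intro continuous_intros)
  have top: "filterlim \<phi> at_bot at_top" and bot: "filterlim \<phi> at_bot at_bot"
    unfolding \<phi>_def using assms(1) by real_asymp+
  have "\<forall>\<^sub>F s in at_top. \<phi> s < 0 \<and> z < s"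
    using top by (intro eventually_conj eventually_gt_at_top) (auto simp: filterlim_at_bot_dense)
  then obtain s2 where s2: "\<phi> s2 < 0" "z < s2"
    using eventually_happens'[OF trivial_limit_at_top_linorder] by blast
  have "\<forall>\<^sub>F s in at_bot. \<phi> s < 0 \<and> s < z"
    using bot by (intro eventually_conj eventually_gt_at_bot) (auto simp: filterlim_at_bot_dense)
  then obtain s1 where s1: "\<phi> s1 < 0" "s1 < z"
    using eventually_happens'[OF trivial_limit_at_bot_linorder] by blast
  obtain s where s: "s \<le> z" "\<phi> s = 0"
    using IVT'[of \<phi> s1 0 z] s1 \<phi>z cont by auto
  obtain s' where s': "z \<le> s'" "\<phi> s' = 0"
    using IVT2'[of \<phi> s2 0 z] s2 \<phi>z cont by auto
  have "s < z" "z < s'" using s s' \<phi>z by (auto simp: less_le)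
  then have "e1 * s < e1 * z" "e1 * z < e1 * s'" using e1 by simp_all
  then have "e0 + e1 * s < 0" "0 < e0 + e1 * s'" using z(1) by linarith+
  then show ?thesis using s(2) s'(2) unfolding \<phi>_def by blast
qed

context separated_quadric
begin

text \<open>The matrix of \<open>l\<close> cancels, so along the line through \<open>x\<close> and
  \<open>y\<close> this is the one-variable situation of
  \<open>quadratic_vs_affine_roots\<close>.\<close>

lemma both_sides:
  fixes \<kappa> p q :: real
  defines "l \<equiv> \<lambda>z. quad_fun K k k0 z + \<kappa> * quad_fun H h h0 z"
  assumes "K + \<kappa> *\<^sub>R H = 0" and "p \<noteq> 0"
  obtains z z' where "p * quad_fun H h h0 z + q * l z = 0" "p * quad_fun H h h0 z' + q * l z' = 0"
    "l z < 0" "0 < l z'"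
proof -
  define \<eta> where "\<eta> = (y - x) \<bullet> (H *v (y - x))"
  have \<eta>: "\<eta> \<noteq> 0" using curvature_nonzero by (simp add: \<eta>_def)
  have l_affine: "l z = quad_fun 0 (k + \<kappa> *\<^sub>R h) (k0 + \<kappa> * h0) z" for z
    using quad_fun_lincomb[of 1 K k k0 z \<kappa> H h h0] assms(2) by (simp add: l_def)
  have l_line: "l (x + s *\<^sub>R (y - x)) = l x + (l y - l x) * s" for s
    unfolding l_affine by (simp add: quad_fun_def inner_add_right inner_diff_right algebra_simps)
  have h_line: "quad_fun H h h0 (x + s *\<^sub>R (y - x)) = - \<eta> * (s - s\<^sup>2)" for s
    unfolding line_eq \<eta>_def[symmetric] by (simp add: algebra_simps)
  have l: "l x < 0" "0 < l x + (l y - l x)" using hx hy kx ky by (simp_all add: l_def)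
  \<comment> \<open>Multiplying the combination by \<sigma> gives \<open>s - s\<^sup>2\<close> the
    positive coefficient \<open>\<sigma> * \<sigma>\<close>, whatever the signs of \<open>p\<close>
    and \<eta>.\<close>
  define \<sigma> where "\<sigma> = - p * \<eta>"
  have \<sigma>: "\<sigma> \<noteq> 0" using assms(3) \<eta> by (simp add: \<sigma>_def)
  then have pos: "0 < \<sigma> * \<sigma>" by (auto simp: zero_less_mult_iff)
  obtain s s' where s: "\<sigma> * \<sigma> * (s - s\<^sup>2) + \<sigma> * q * (l x + (l y - l x) * s) = 0"
      "\<sigma> * \<sigma> * (s' - s'\<^sup>2) + \<sigma> * q * (l x + (l y - l x) * s') = 0"
      "l x + (l y - l x) * s < 0" "0 < l x + (l y - l x) * s'"
    using quadratic_vs_affine_roots[OF pos l, of "\<sigma> * q"] by blast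
  have "\<sigma> * (p * quad_fun H h h0 (x + r *\<^sub>R (y - x)) + q * l (x + r *\<^sub>R (y - x)))
      = \<sigma> * \<sigma> * (r - r\<^sup>2) + \<sigma> * q * (l x + (l y - l x) * r)" for r
    unfolding h_line l_line by (simp add: \<sigma>_def algebra_simps)
  with s \<sigma> have "p * quad_fun H h h0 (x + s *\<^sub>R (y - x)) + q * l (x + s *\<^sub>R (y - x)) = 0"
      "p * quad_fun H h h0 (x + s' *\<^sub>R (y - x)) + q * l (x + s' *\<^sub>R (y - x)) = 0"
    by (metis mult_eq_0_iff)+
  with s show ?thesis using that l_line by metis
qed

end

section \<open>Separation and missed points of chords\<close>

text \<open>The pairwise condition fixes one sign on all of \<open>Lm\<close> and the opposite one
  on all of \<open>Lp\<close>, so these are the parts of the level set below and above \<beta>, in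
  either order.\<close>

lemma level_separates_iff:
  "level_separates g \<beta> f \<alpha> \<longleftrightarrow>
    (\<nexists>z. f z = \<alpha> \<and> g z = \<beta>) \<and> (\<exists>x. f x = \<alpha> \<and> g x < \<beta>) \<and> (\<exists>y. f y = \<alpha> \<and> \<beta> < g y)"
proof
  assume "level_separates g \<beta> f \<alpha>"
  then obtain Lm Lp u w where L: "Lm \<union> Lp = level_set f \<alpha>"
      "\<And>um up. um \<in> Lm \<Longrightarrow> up \<in> Lp \<Longrightarrow> (g um - \<beta>) * (g up - \<beta>) < 0"
      "u \<in> Lm" "w \<in> Lp"
    unfolding level_separates_def by blast
  have "f u = \<alpha>" "f w = \<alpha>" using L by (auto simp: level_set_def)
  \<comment> \<open>\<open>z\<close> lies in \<open>Lm\<close> or \<open>Lp\<close>; paired with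
    \<open>w\<close> or \<open>u\<close> it gives a nonzero product.\<close>
  moreover have "g z \<noteq> \<beta>" if "f z = \<alpha>" for z
    using that L(1) L(2)[of z w] L(2)[of u z] L(3,4) by (fastforce simp: level_set_def)
  moreover have "(g u - \<beta>) * (g w - \<beta>) < 0" using L by blast
  then have "g u < \<beta> \<and> \<beta> < g w \<or> g w < \<beta> \<and> \<beta> < g u" by (auto simp: mult_less_0_iff)
  ultimately show "(\<nexists>z. f z = \<alpha> \<and> g z = \<beta>) \<and> (\<exists>x. f x = \<alpha> \<and> g x < \<beta>) \<and> (\<exists>y. f y = \<alpha> \<and> \<beta> < g y)"
    by blast
next
  assume *: "(\<nexists>z. f z = \<alpha> \<and> g z = \<beta>) \<and> (\<exists>x. f x = \<alpha> \<and> g x < \<beta>) \<and> (\<exists>y. f y = \<alpha> \<and> \<beta> < g y)"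
  show "level_separates g \<beta> f \<alpha>"
    unfolding level_separates_def
  proof (intro exI conjI)
    show "{z. f z = \<alpha> \<and> g z < \<beta>} \<union> {z. f z = \<alpha> \<and> \<beta> < g z} = level_set f \<alpha>"
      using * by (auto simp: level_set_def)
  qed (use * in \<open>auto simp: level_set_def mult_less_0_iff\<close>)
qed

text \<open>Reads separation as a chord of the joint range through the missed point
  \<open>(\<alpha>, \<beta>)\<close>; exchanging \<open>f\<close> and \<open>g\<close> covers the
  other direction.\<close>

lemma level_separates_imp_gap:
  assumes "level_separates g \<beta> f \<alpha>"
  obtains x y t where "t \<in> {0..1}" "f x = \<alpha>" "f y = \<alpha>" "(1 - t) * g x + t * g y = \<beta>"
    "\<And>z. \<not> (f z = \<alpha> \<and> g z = \<beta>)"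
proof -
  obtain x y where xy: "f x = \<alpha>" "g x < \<beta>" "f y = \<alpha>" "\<beta> < g y" and nz: "\<And>z. \<not> (f z = \<alpha> \<and> g z = \<beta>)"
    using assms unfolding level_separates_iff by blast
  have "(1 - (\<beta> - g x) / (g y - g x)) * g x + (\<beta> - g x) / (g y - g x) * g y
      = g x + (\<beta> - g x) / (g y - g x) * (g y - g x)" by (simp only: algebra_simps)
  also have "\<dots> = \<beta>" using xy by simp
  finally show ?thesis using xy nz by (intro that[of "(\<beta> - g x) / (g y - g x)" x y]) auto
qed

lemma level_separates_imp_not_convex:
  assumes "level_separates g \<beta> f \<alpha> \<or> level_separates f \<alpha> g \<beta>"
  shows "\<not> convex (joint_range f g)"
proof
  assume "convex (joint_range f g)"
  then have conv: "\<exists>z. f z = (1 - t) * f x + t * f y \<and> g z = (1 - t) * g x + t * g y"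
    if "t \<in> {0..1}" for x y t
  proof -
    have "(1 - t) *\<^sub>R (f x, g x) + t *\<^sub>R (f y, g y) \<in> joint_range f g"
      using \<open>convex (joint_range f g)\<close> that
      by (intro convexD) (auto simp: joint_range_def)
    then show ?thesis by (auto simp: joint_range_def)
  qed
  from assms show False
  proof
    assume "level_separates g \<beta> f \<alpha>"
    then obtain x y t where *: "t \<in> {0..1}" "f x = \<alpha>" "f y = \<alpha>" "(1 - t) * g x + t * g y = \<beta>"
      "\<And>z. \<not> (f z = \<alpha> \<and> g z = \<beta>)" by (rule level_separates_imp_gap) blast
    have "(1 - t) * \<alpha> + t * \<alpha> = \<alpha>" by (simp add: algebra_simps)
    with conv[of t x y] * show False by simp
  next
    assume "level_separates f \<alpha> g \<beta>"
    then obtain x y t where *: "t \<in> {0..1}" "g x = \<beta>" "g y = \<beta>" "(1 - t) * f x + t * f y = \<alpha>"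
      "\<And>z. \<not> (g z = \<beta> \<and> f z = \<alpha>)" by (rule level_separates_imp_gap) blast
    have "(1 - t) * \<beta> + t * \<beta> = \<beta>" by (simp add: algebra_simps)
    with conv[of t x y] * show False by auto
  qed
qed

section \<open>From a missed point to separating levels\<close>

text \<open>One pair \<alpha>, \<beta> serves both implications, which yields mutual separation when
  both matrices are nonzero. The last conclusion rules out two affine functions.\<close>

lemma not_convex_imp_level_separates:
  fixes A B :: "real^'n^'n"
  assumes symA: "transpose A = A" and symB: "transpose B = B"
    and f: "f = quad_fun A a a0" and g: "g = quad_fun B b b0"
    and "\<not> convex (joint_range f g)"
  obtains \<alpha> \<beta> where "A \<noteq> 0 \<Longrightarrow> level_separates g \<beta> f \<alpha>" "B \<noteq> 0 \<Longrightarrow> level_separates f \<alpha> g \<beta>"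
    "A \<noteq> 0 \<or> B \<noteq> 0"
proof -
  obtain x y t where t: "0 \<le> t" "t \<le> 1"
    and notin: "(1 - t) *\<^sub>R (f x, g x) + t *\<^sub>R (f y, g y) \<notin> joint_range f g"
    using assms(5) unfolding convex_alt by (auto simp: joint_range_def)
  define \<alpha> \<beta> where "\<alpha> = (1 - t) * f x + t * f y" and "\<beta> = (1 - t) * g x + t * g y"
  have "(\<alpha>, \<beta>) \<notin> joint_range f g"
    using notin by (simp add: \<alpha>_def \<beta>_def)
  moreover have "(f z, g z) \<in> joint_range f g" for z
    by (simp add: joint_range_def)
  ultimately have nz: "\<not> (f z = \<alpha> \<and> g z = \<beta>)" for z
    by metis
  have t01: "t \<noteq> 0" "t \<noteq> 1"
  proof -
    have "t = 0 \<Longrightarrow> f x = \<alpha> \<and> g x = \<beta>" "t = 1 \<Longrightarrow> f y = \<alpha> \<and> g y = \<beta>"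
      by (simp_all add: \<alpha>_def \<beta>_def)
    then show "t \<noteq> 0" "t \<noteq> 1" using nz by blast+
  qed
  \<comment> \<open>Direction and squared length of the chord; a chord of length zero would be the
    image of \<open>x\<close> and miss nothing.\<close>
  define d1 d2 where "d1 = f y - f x" and "d2 = g y - g x"
  define D where "D = d1\<^sup>2 + d2\<^sup>2"
  have "\<alpha> = f x + t * d1" "\<beta> = g x + t * d2"
    by (simp_all add: \<alpha>_def \<beta>_def d1_def d2_def algebra_simps)
  then have "\<not> (d1 = 0 \<and> d2 = 0)" using nz[of x] by auto
  then have D: "0 < D" unfolding D_def by (simp add: sum_power2_gt_zero_iff)
  \<comment> \<open>Up to the factor \<open>sqrt D\<close>, these are the components of
    \<open>(f - \<alpha>, g - \<beta>)\<close> across and along the chord; \<open>fD\<close> and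
    \<open>gD\<close> invert this rotation.\<close>
  define H where "H = d2 *\<^sub>R A + (- d1) *\<^sub>R B"
  define K where "K = d1 *\<^sub>R A + d2 *\<^sub>R B"
  define h where "h = d2 *\<^sub>R a + (- d1) *\<^sub>R b"
  define k where "k = d1 *\<^sub>R a + d2 *\<^sub>R b"
  define h0 where "h0 = d2 * (a0 - \<alpha>) + (- d1) * (b0 - \<beta>)"
  define k0 where "k0 = d1 * (a0 - \<alpha>) + d2 * (b0 - \<beta>)"
  have hz: "quad_fun H h h0 z = d2 * (f z - \<alpha>) - d1 * (g z - \<beta>)" for z
    using quad_fun_lincomb[of d2 A a "a0 - \<alpha>" z "- d1" B b "b0 - \<beta>"]
    by (simp add: H_def h_def h0_def f g quad_fun_diff_const)
  have kz: "quad_fun K k k0 z = d1 * (f z - \<alpha>) + d2 * (g z - \<beta>)" for z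
    using quad_fun_lincomb[of d1 A a "a0 - \<alpha>" z d2 B b "b0 - \<beta>"]
    by (simp add: K_def k_def k0_def f g quad_fun_diff_const)
  have fD: "D * (f z - \<alpha>) = d2 * quad_fun H h h0 z + d1 * quad_fun K k k0 z" for z
    unfolding hz kz D_def by (simp add: algebra_simps power2_eq_square)
  have gD: "D * (g z - \<beta>) = - d1 * quad_fun H h h0 z + d2 * quad_fun K k k0 z" for z
    unfolding hz kz D_def by (simp add: algebra_simps power2_eq_square)
  have fx: "f x - \<alpha> = - t * d1" "g x - \<beta> = - t * d2" "f y - \<alpha> = (1 - t) * d1" "g y - \<beta> = (1 - t) * d2"
    by (simp_all add: \<alpha>_def \<beta>_def d1_def d2_def algebra_simps)
  interpret separated_quadric H K h k h0 k0 x y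
  proof
    show "transpose H = H" "transpose K = K"
      unfolding H_def K_def by (intro transpose_lincomb symA symB)+
    show "quad_fun H h h0 x = 0" "quad_fun H h h0 y = 0"
      unfolding hz fx by simp_all
    have "quad_fun K k k0 x = - (t * D)" "quad_fun K k k0 y = (1 - t) * D"
      unfolding kz fx D_def by (simp_all add: algebra_simps power2_eq_square)
    then show "quad_fun K k k0 x < 0" "0 < quad_fun K k k0 y"
      using t t01 D by simp_all
    show "quad_fun K k k0 z \<noteq> 0" if "quad_fun H h h0 z = 0" for z
      using fD[of z] gD[of z] that nz[of z] D by auto
  qed
  obtain \<kappa> where \<kappa>: "K + \<kappa> *\<^sub>R H = 0" using matrices_dependent by blast
  define l where "l = (\<lambda>z. quad_fun K k k0 z + \<kappa> * quad_fun H h h0 z)"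
  \<comment> \<open>Coefficients of \<open>quad_fun H h h0\<close> once
    \<open>quad_fun K k k0\<close> is replaced through \<open>l\<close> in \<open>fD\<close> and
    \<open>gD\<close>.\<close>
  define p r where "p = d2 - d1 * \<kappa>" and "r = - d1 - d2 * \<kappa>"
  have K: "K = - \<kappa> *\<^sub>R H" using \<kappa> by (simp add: eq_neg_iff_add_eq_0)
  have "D *\<^sub>R A = d2 *\<^sub>R H + d1 *\<^sub>R K" "D *\<^sub>R B = (- d1) *\<^sub>R H + d2 *\<^sub>R K"
    by (simp_all add: H_def K_def D_def vec_eq_iff power2_eq_square algebra_simps)
  \<comment> \<open>Hence \<open>A \<noteq> 0\<close> forces \<open>p \<noteq> 0\<close>, and
    \<open>B \<noteq> 0\<close> forces \<open>r \<noteq> 0\<close>.\<close>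
  then have AB: "D *\<^sub>R A = p *\<^sub>R H" "D *\<^sub>R B = r *\<^sub>R H"
    by (simp_all add: K p_def r_def algebra_simps)
  have fl: "D * (f z - \<alpha>) = p * quad_fun H h h0 z + d1 * l z" for z
    unfolding fD l_def p_def by (simp add: algebra_simps)
  have gl: "D * (g z - \<beta>) = r * quad_fun H h h0 z + d2 * l z" for z
    unfolding gD l_def r_def by (simp add: algebra_simps)
  \<comment> \<open>Eliminates \<open>quad_fun H h h0\<close>; the determinant
    \<open>p * d2 - r * d1\<close> equals \<open>D\<close>.\<close>
  have "p * (D * (g z - \<beta>)) - r * (D * (f z - \<alpha>)) = D * l z" for z
    unfolding fl gl by (simp add: p_def r_def D_def power2_eq_square algebra_simps)
  then have "D * (p * (g z - \<beta>) - r * (f z - \<alpha>)) = D * l z" for z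
    by (simp add: algebra_simps)
  then have pr: "p * (g z - \<beta>) - r * (f z - \<alpha>) = l z" for z
    using D by simp
  show ?thesis
  proof (rule that)
    assume "A \<noteq> 0"
    then have p: "p \<noteq> 0" using AB D by auto
    obtain z z' where z: "p * quad_fun H h h0 z + d1 * l z = 0" "p * quad_fun H h h0 z' + d1 * l z' = 0"
      "l z < 0" "0 < l z'"
      unfolding l_def by (rule both_sides[OF \<kappa> p, of d1]) blast
    then have fz: "f z = \<alpha>" "f z' = \<alpha>" using D by (simp_all flip: fl)
    \<comment> \<open>On \<open>f = \<alpha>\<close>, \<open>pr\<close> reduces to
      \<open>p * (g z - \<beta>) = l z\<close>, so \<open>g - \<beta>\<close> takes both signs, in
      an order set by the sign of \<open>p\<close>.\<close>
    then have "p * (g z - \<beta>) < 0" "0 < p * (g z' - \<beta>)" using z(3,4) by (simp_all flip: pr)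
    then show "level_separates g \<beta> f \<alpha>"
      unfolding level_separates_iff using fz nz by (auto simp: mult_less_0_iff zero_less_mult_iff)
  next
    assume "B \<noteq> 0"
    then have r: "r \<noteq> 0" using AB D by auto
    obtain z z' where z: "r * quad_fun H h h0 z + d2 * l z = 0" "r * quad_fun H h h0 z' + d2 * l z' = 0"
      "l z < 0" "0 < l z'"
      unfolding l_def by (rule both_sides[OF \<kappa> r, of d2]) blast
    then have gz: "g z = \<beta>" "g z' = \<beta>" using D by (simp_all flip: gl)
    then have "0 < r * (f z - \<alpha>)" "r * (f z' - \<alpha>) < 0" using z(3,4) by (simp_all flip: pr)
    then show "level_separates f \<alpha> g \<beta>"
      unfolding level_separates_iff using gz nz by (auto simp: mult_less_0_iff zero_less_mult_iff)
  next
    \<comment> \<open>A zero \<open>H\<close> would have zero curvature along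
      \<open>y - x\<close>.\<close>
    have "H \<noteq> 0" using curvature_nonzero by auto
    then show "A \<noteq> 0 \<or> B \<noteq> 0" by (auto simp: H_def)
  qed
qed

theorem theorem3p1:
  fixes A B :: "real^'n^'n" and a b :: "real^'n" and a0 b0 :: real
    and f g :: "real^'n \<Rightarrow> real"
  assumes "transpose A = A" and "transpose B = B"
    and "f = quad_fun A a a0" and "g = quad_fun B b b0"
  shows "(\<not> convex (joint_range f g) \<longleftrightarrow>
            (\<exists>\<alpha> \<beta>. level_separates g \<beta> f \<alpha> \<or> level_separates f \<alpha> g \<beta>)) \<and>
         (A \<noteq> 0 \<and> B \<noteq> 0 \<longrightarrow>
           (\<not> convex (joint_range f g) \<longleftrightarrow>
             (\<exists>\<alpha> \<beta>. level_separates g \<beta> f \<alpha> \<and> level_separates f \<alpha> g \<beta>))) \<and>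
         (B = 0 \<and> A \<noteq> 0 \<longrightarrow>
           (\<not> convex (joint_range f g) \<longleftrightarrow>
             (\<exists>\<alpha> \<beta>. level_separates g \<beta> f \<alpha>))) \<and>
         (A = 0 \<and> B \<noteq> 0 \<longrightarrow>
           (\<not> convex (joint_range f g) \<longleftrightarrow>
             (\<exists>\<alpha> \<beta>. level_separates f \<beta> g \<alpha>)))"
proof -
  \<comment> \<open>Every separation condition in the claim implies this disjunction, so one
    argument settles all converse directions.\<close>
  have conv: "\<not> convex (joint_range f g)"
    if "\<exists>\<alpha> \<beta>. level_separates g \<beta> f \<alpha> \<or> level_separates f \<alpha> g \<beta>"
    using that level_separates_imp_not_convex by blast
  show ?thesis
  proof (cases "convex (joint_range f g)")
    case True
    with conv show ?thesis by blast
  next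
    case False
    with assms obtain \<alpha> \<beta> where "A \<noteq> 0 \<Longrightarrow> level_separates g \<beta> f \<alpha>"
      "B \<noteq> 0 \<Longrightarrow> level_separates f \<alpha> g \<beta>" "A \<noteq> 0 \<or> B \<noteq> 0"
      by (rule not_convex_imp_level_separates) blast
    with False show ?thesis by blast
  qed
qed

end
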